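(* For every integer $k\ge 2$ let $d(k)$ be the minimum integer $m$ such that every tournament $T$ with minimum out-degree $\delta^{+}(T)\ge m$ contains a subdivision of $\overrightarrow{K}_k$. Then \[ k^2/4 \le d(k) \le (2+o(1))k^2, \] where the $o(1)$ term tends to $0$ as $k\to\infty$.
   Context: A tournament is a directed graph in which every pair of distinct vertices is joined by exactly one directed edge. $\overrightarrow{K}_k$ is the complete directed graph on $k$ vertices (every ordered pair of distinct vertices joined by an edge in that direction). A tournament $T$ contains a subdivision of $\overrightarrow{K}_k$ if there is a set $B$ of $k$ vertices (branch vertices) and, for every ordered pair $(x,y)$ of distinct vertices of $B$, a directed path from $x$ to $y$ in $T$, such that these $2\binom{k}{2}$ paths are pairwise internally vertex-disjoint and their internal vertices lie outside $B$. $\delta^+(T)$ denotes the minimum out-degree of $T$. *)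

theory Defs
  imports Complex_Main "Graph_Theory.Pair_Digraph" "Graph_Theory.Vertex_Walk"
begin

(* pair_digraph: finite, loop-free, no parallel arcs. The null digraph is excluded because it
   has no minimum out-degree. *)
locale tournament = pair_digraph T for T :: "'a pair_pre_digraph" +
  assumes nonempty_verts: "pverts T \<noteq> {}"
    and exactly_one_arc:
      "\<lbrakk>u \<in> pverts T; v \<in> pverts T; u \<noteq> v\<rbrakk> \<Longrightarrow> ((u, v) \<in> parcs T) \<noteq> ((v, u) \<in> parcs T)"

definition min_out_degree :: "('a, 'b) pre_digraph \<Rightarrow> nat" where
  "min_out_degree G = Min (out_degree G ` verts G)"

definition internal_verts :: "'a vwalk \<Rightarrow> 'a set" where
  "internal_verts p = set (butlast (tl p))"

(* The constant subdivision of the Graph_Theory library relates symmetric digraphs only and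
   replaces an arc together with its reverse, so it does not apply to subdivisions of the
   complete digraph inside a tournament. *)
definition contains_complete_subdivision :: "('a, 'b) pre_digraph \<Rightarrow> nat \<Rightarrow> bool" where
  "contains_complete_subdivision G k \<longleftrightarrow>
    (\<exists>B P. B \<subseteq> verts G \<and> finite B \<and> card B = k \<and>
      (\<forall>x\<in>B. \<forall>y\<in>B. x \<noteq> y \<longrightarrow>
         vpath (P x y) G \<and> hd (P x y) = x \<and> last (P x y) = y \<and>
         internal_verts (P x y) \<inter> B = {}) \<and>
      (\<forall>x\<in>B. \<forall>y\<in>B. \<forall>x'\<in>B. \<forall>y'\<in>B.
         x \<noteq> y \<longrightarrow> x' \<noteq> y' \<longrightarrow> (x, y) \<noteq> (x', y') \<longrightarrow>
         internal_verts (P x y) \<inter> internal_verts (P x' y') = {}))"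

(* Every finite tournament is isomorphic to one with vertices in nat; see
   forces_complete_subdivision_any_type. *)
definition forces_complete_subdivision :: "nat \<Rightarrow> nat \<Rightarrow> bool" where
  "forces_complete_subdivision k m \<longleftrightarrow>
    (\<forall>T :: nat pair_pre_digraph. tournament T \<longrightarrow> m \<le> min_out_degree (with_proj T) \<longrightarrow>
       contains_complete_subdivision (with_proj T) k)"

(* Unspecified if no m forces a subdivision, so existence has to be stated separately. *)
definition d_min :: "nat \<Rightarrow> nat" where
  "d_min k = (LEAST m. forces_complete_subdivision k m)"

lemma internal_verts_subset: "internal_verts p \<subseteq> set p"
  unfolding internal_verts_def by (cases p) (auto dest: in_set_butlastD)

lemma internal_verts_map: "internal_verts (map f p) = f ` internal_verts p"
  by (simp add: internal_verts_def map_tl[symmetric] map_butlast[symmetric])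

lemma vwalk_arcs_map: "vwalk_arcs (map f p) = map (map_prod f f) (vwalk_arcs p)"
  by (induct p rule: vwalk_arcs.induct) auto

lemma forces_complete_subdivision_any_type:
  fixes T :: "'a pair_pre_digraph"
  assumes "forces_complete_subdivision k m" "tournament T" "m \<le> min_out_degree (with_proj T)"
  shows "contains_complete_subdivision (with_proj T) k"
proof -
  interpret tournament T by fact
  have "finite (pverts T)" by (rule pair_finite_verts)
  then obtain f :: "'a \<Rightarrow> nat" where f: "inj_on f (pverts T)"
    using finite_imp_inj_to_nat_seg by blast
  have arc_verts: "u \<in> pverts T" "v \<in> pverts T" if "(u, v) \<in> parcs T" for u v
    using arc_fst_in_verts[OF that] arc_snd_in_verts[OF that] by auto
  define g where "g = the_inv_into (pverts T) f"
  have gf: "g (f u) = u" if "u \<in> pverts T" for u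
    using f that by (simp add: g_def the_inv_into_f_f)
  define S where "S = \<lparr>pverts = f ` pverts T, parcs = map_prod f f ` parcs T\<rparr>"
  have arcS: "(f u, f v) \<in> parcs S \<longleftrightarrow> (u, v) \<in> parcs T"
    if "u \<in> pverts T" "v \<in> pverts T" for u v
  proof
    assume "(f u, f v) \<in> parcs S"
    then obtain a b where ab: "(a, b) \<in> parcs T" "f u = f a" "f v = f b"
      by (auto simp: S_def)
    have "u = a" "v = b"
      using inj_onD[OF f ab(2)] inj_onD[OF f ab(3)] that arc_verts[OF ab(1)] by simp_all
    with ab show "(u, v) \<in> parcs T" by simp
  next
    assume "(u, v) \<in> parcs T"
    then show "(f u, f v) \<in> parcs S" by (force simp: S_def)
  qed
  have "tournament S"
  proof
    show "finite (pverts S)" "finite (parcs S)"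
      using pair_finite_verts pair_finite_arcs by (auto simp: S_def)
    show "pverts S \<noteq> {}" using nonempty_verts by (simp add: S_def)
    show "fst e \<in> pverts S" "snd e \<in> pverts S" if "e \<in> parcs S" for e
      using that arc_verts by (auto simp: S_def)
    show "fst e \<noteq> snd e" if "e \<in> parcs S" for e
    proof -
      from that obtain a b where ab: "(a, b) \<in> parcs T" "e = (f a, f b)"
        by (auto simp: S_def)
      with pair_no_loops[OF ab(1)] arc_verts[OF ab(1)] f show ?thesis
        by (auto dest: inj_onD)
    qed
    show "((u, v) \<in> parcs S) \<noteq> ((v, u) \<in> parcs S)"
      if uv: "u \<in> pverts S" "v \<in> pverts S" "u \<noteq> v" for u v
    proof -
      obtain a b where "a \<in> pverts T" "b \<in> pverts T" "u = f a" "v = f b"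
        using uv by (auto simp: S_def)
      moreover from this uv have "a \<noteq> b" by auto
      ultimately show ?thesis
        using exactly_one_arc[of a b] arcS[of a b] arcS[of b a] by simp
    qed
  qed
  have "out_degree (with_proj S) (f v) = out_degree (with_proj T) v" if v: "v \<in> pverts T" for v
  proof -
    have "out_arcs (with_proj S) (f v) = map_prod f f ` out_arcs (with_proj T) v"
      using v arc_verts f by (force simp: out_arcs_def S_def dest: inj_onD)
    moreover have "inj_on (map_prod f f) (out_arcs (with_proj T) v)"
      using f arc_verts by (auto simp: inj_on_def out_arcs_def)
    ultimately show ?thesis
      by (simp add: out_degree_def card_image)
  qed
  then have "min_out_degree (with_proj S) = min_out_degree (with_proj T)"
    unfolding min_out_degree_def by (simp add: S_def image_image)
  with assms(1,3) \<open>tournament S\<close> have "contains_complete_subdivision (with_proj S) k"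
    by (simp add: forces_complete_subdivision_def)
  then obtain B P where B: "B \<subseteq> verts (with_proj S)" "finite B" "card B = k"
    and P_all: "\<forall>x\<in>B. \<forall>y\<in>B. x \<noteq> y \<longrightarrow>
        vpath (P x y) (with_proj S) \<and> hd (P x y) = x \<and> last (P x y) = y \<and>
        internal_verts (P x y) \<inter> B = {}"
    and D_all: "\<forall>x\<in>B. \<forall>y\<in>B. \<forall>x'\<in>B. \<forall>y'\<in>B.
        x \<noteq> y \<longrightarrow> x' \<noteq> y' \<longrightarrow> (x, y) \<noteq> (x', y') \<longrightarrow>
        internal_verts (P x y) \<inter> internal_verts (P x' y') = {}"
    unfolding contains_complete_subdivision_def by (elim exE conjE) (rule that)
  have B_S: "B \<subseteq> pverts S" using B(1) by simp
  note P = P_all[rule_format] and D = D_all[rule_format]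
  have fg: "f (g w) = w" and gS: "g w \<in> pverts T" if "w \<in> pverts S" for w
    using that gf by (auto simp: S_def)
  have injg: "inj_on g (pverts S)" by (metis fg inj_onI)
  have disj: "g ` X \<inter> g ` Y = {}" if "X \<inter> Y = {}" "X \<subseteq> pverts S" "Y \<subseteq> pverts S" for X Y
    using inj_on_image_Int[OF injg that(2,3)] that(1) by auto
  define Q where "Q x y = map g (P (f x) (f y))" for x y
  have Q: "vpath (Q (g x) (g y)) (with_proj T) \<and> hd (Q (g x) (g y)) = g x \<and>
      last (Q (g x) (g y)) = g y \<and> internal_verts (Q (g x) (g y)) \<inter> g ` B = {} \<and>
      internal_verts (Q (g x) (g y)) = g ` internal_verts (P x y) \<and>
      internal_verts (P x y) \<subseteq> pverts S"
    if xy: "x \<in> B" "y \<in> B" "x \<noteq> y" for x y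
  proof -
    have e: "Q (g x) (g y) = map g (P x y)"
      using xy B_S fg[of x] fg[of y] by (auto simp: Q_def subset_iff)
    have p: "set (P x y) \<subseteq> pverts S" "set (vwalk_arcs (P x y)) \<subseteq> parcs S"
      "P x y \<noteq> []" "distinct (P x y)"
      using P[OF xy] by (auto simp: vpath_def vwalk_def)
    have "map_prod g g e \<in> parcs T" if "e \<in> parcs S" for e
      using that gf arc_verts by (auto simp: S_def)
    with p gS have "vwalk (map g (P x y)) (with_proj T)"
      by (auto simp: vwalk_def vwalk_arcs_map)
    moreover have "distinct (map g (P x y))"
      using p(4) inj_on_subset[OF injg p(1)] by (simp add: distinct_map)
    moreover have i: "internal_verts (P x y) \<subseteq> pverts S"
      using internal_verts_subset p(1) by (rule subset_trans)
    moreover have "g ` internal_verts (P x y) \<inter> g ` B = {}"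
      using P[OF xy] by (intro disj i B_S) auto
    ultimately show ?thesis
      using P[OF xy] p(3) by (simp add: e vpath_def internal_verts_map hd_map last_map)
  qed
  have injB: "inj_on g B" using injg B_S by (rule inj_on_subset)
  show ?thesis
    unfolding contains_complete_subdivision_def
  proof (intro exI[of _ "g ` B"] exI[of _ Q] conjI)
    show "g ` B \<subseteq> verts (with_proj T)" using B_S gS by auto
    show "finite (g ` B)" "card (g ` B) = k" using B injB by (auto simp: card_image)
    show "\<forall>x\<in>g ` B. \<forall>y\<in>g ` B. x \<noteq> y \<longrightarrow> vpath (Q x y) (with_proj T) \<and> hd (Q x y) = x \<and>
        last (Q x y) = y \<and> internal_verts (Q x y) \<inter> g ` B = {}"
    proof (intro ballI impI)
      fix a b assume "a \<in> g ` B" "b \<in> g ` B" "a \<noteq> b"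
      then obtain x y where xy: "x \<in> B" "y \<in> B" "a = g x" "b = g y" by (elim imageE)
      with \<open>a \<noteq> b\<close> have "x \<noteq> y" by metis
      show "vpath (Q a b) (with_proj T) \<and> hd (Q a b) = a \<and> last (Q a b) = b \<and>
          internal_verts (Q a b) \<inter> g ` B = {}"
        unfolding xy(3,4) using Q[OF xy(1,2) \<open>x \<noteq> y\<close>] by (elim conjE) (intro conjI)
    qed
    show "\<forall>x\<in>g ` B. \<forall>y\<in>g ` B. \<forall>x'\<in>g ` B. \<forall>y'\<in>g ` B. x \<noteq> y \<longrightarrow> x' \<noteq> y' \<longrightarrow>
        (x, y) \<noteq> (x', y') \<longrightarrow> internal_verts (Q x y) \<inter> internal_verts (Q x' y') = {}"
    proof (intro ballI impI)
      fix a b a' b'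
      assume ab: "a \<in> g ` B" "b \<in> g ` B" "a' \<in> g ` B" "b' \<in> g ` B"
        "a \<noteq> b" "a' \<noteq> b'" "(a, b) \<noteq> (a', b')"
      obtain x y x' y' where xy: "x \<in> B" "y \<in> B" "x' \<in> B" "y' \<in> B"
        and e: "a = g x" "b = g y" "a' = g x'" "b' = g y'"
        using ab(1-4) by (elim imageE)
      have ne: "x \<noteq> y" "x' \<noteq> y'" "(x, y) \<noteq> (x', y')" using ab(5-7) unfolding e by auto
      have "g ` internal_verts (P x y) \<inter> g ` internal_verts (P x' y') = {}"
        by (rule disj[OF D[OF xy ne]]) (simp_all add: Q xy ne(1,2))
      then show "internal_verts (Q a b) \<inter> internal_verts (Q a' b') = {}"
        unfolding e using Q[OF xy(1,2) ne(1)] Q[OF xy(3,4) ne(2)] by simp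
    qed
  qed
qed

end

theory Submission
  imports Defs
begin

text \<open>Upper bound: after shrinking the tournament, \<open>k\<close> vertices have out-degree within \<open>k\<close> of the
  minimum \<open>m\<close>; they serve as branch vertices. Exactly one of \<open>(x, y)\<close>, \<open>(y, x)\<close> is an arc,
  so about \<open>k\<^sup>2 / 2\<close> pairs need a path, and these are linked greedily by paths with one or two
  internal vertices. If no such path from \<open>x\<close> to \<open>y\<close> avoids the used set \<open>W\<close>, then
  \<open>P = N\<^sup>+(x) - W\<close> and all out-neighbours of \<open>P\<close> outside \<open>W\<close> lie in \<open>N\<^sup>+(y)\<close>; a vertex of \<open>P\<close>
  with at most half of \<open>P\<close> as out-neighbours then has too small an out-degree, provided
  \<open>N\<^sup>+(x)\<close> does not meet \<open>W\<close> much more than \<open>N\<^sup>+(y)\<close> does. The order of linking ensures this.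

  Lower bound: each of the \<open>k (k - 1) / 2\<close> pairs that are not arcs uses up an internal vertex, so
  a subdivision needs \<open>k (k + 1) / 2\<close> vertices, while a regular tournament of out-degree \<open>m\<close> has
  only \<open>2 m + 1\<close>.\<close>

context tournament
begin

section \<open>Arc counts and branch vertices of low out-degree\<close>

definition outs :: "'a set \<Rightarrow> 'a \<Rightarrow> 'a set" where
  "outs V v = {w \<in> V. (v, w) \<in> parcs T}"

lemma finite_outs: "V \<subseteq> pverts T \<Longrightarrow> finite (outs V v)"
  unfolding outs_def using finite_subset[OF _ pair_finite_verts] by auto

lemma not_loop: "(v, v) \<notin> parcs T"
  using pair_no_loops[of "(v, v)"] by auto

text \<open>The arcs inside \<open>S\<close>, their reverses and the diagonal partition
  \<open>S \<times> S\<close>.\<close>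

lemma card_arcs_within:
  assumes "S \<subseteq> pverts T"
  shows "2 * card {e \<in> S \<times> S. e \<in> parcs T} + card S = card S * card S"
proof -
  let ?F = "{e \<in> S \<times> S. e \<in> parcs T}"
  have fin: "finite S" using assms finite_subset pair_finite_verts by blast
  have fF: "finite ?F" using fin by simp
  have part: "S \<times> S = (?F \<union> prod.swap ` ?F) \<union> Id_on S"
  proof (intro equalityI subsetI)
    fix e assume "e \<in> S \<times> S"
    then obtain u v where e: "e = (u, v)" "u \<in> S" "v \<in> S" by auto
    show "e \<in> (?F \<union> prod.swap ` ?F) \<union> Id_on S"
    proof (cases "u = v \<or> (u, v) \<in> parcs T")
      case True
      with e show ?thesis by auto
    next
      case False
      with e assms exactly_one_arc[of u v] have "(v, u) \<in> ?F" by auto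
      then have "prod.swap (v, u) \<in> prod.swap ` ?F" by (rule imageI)
      with e show ?thesis by simp
    qed
  qed auto
  have "?F \<inter> prod.swap ` ?F = {}"
    using exactly_one_arc assms not_loop by (auto simp: subset_iff) metis
  moreover have "(?F \<union> prod.swap ` ?F) \<inter> Id_on S = {}"
    using not_loop by auto
  moreover have "card (prod.swap ` ?F) = card ?F" by (simp add: card_image)
  moreover have "Id_on S = (\<lambda>v. (v, v)) ` S" by auto
  then have "card (Id_on S) = card S" "finite (Id_on S)"
    using fin by (simp_all add: card_image inj_on_def)
  ultimately have "card (S \<times> S) = 2 * card ?F + card S"
    using fF by (subst part) (simp add: card_Un_disjoint)
  then show ?thesis by (simp add: card_cartesian_product)
qed

text \<open>The mean out-degree inside \<open>S\<close> is \<open>(card S - 1) / 2\<close>, and some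
  vertex does not exceed the mean.\<close>

lemma ex_low_out_degree:
  assumes "S \<subseteq> pverts T" "S \<noteq> {}"
  shows "\<exists>p\<in>S. 2 * card (outs S p) < card S"
proof (rule ccontr)
  have fin: "finite S" using assms(1) finite_subset pair_finite_verts by blast
  assume "\<not> ?thesis"
  then have "(\<Sum>p\<in>S. card S) \<le> (\<Sum>p\<in>S. 2 * card (outs S p))"
    by (intro sum_mono) (auto simp: not_less)
  also have "\<dots> = 2 * card (Sigma S (outs S))"
    using fin by (simp add: sum_distrib_left outs_def)
  also have "Sigma S (outs S) = {e \<in> S \<times> S. e \<in> parcs T}"
    by (auto simp: outs_def)
  finally have "card S * card S \<le> 2 * card {e \<in> S \<times> S. e \<in> parcs T}" by simp
  moreover have "card S > 0" using fin assms(2) by (simp add: card_gt_0_iff)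
  ultimately show False using card_arcs_within[OF assms(1)] by linarith
qed

lemma out_degree_eq_card_outs: "out_degree (with_proj T) v = card (outs (pverts T) v)"
proof -
  have "out_arcs (with_proj T) v = Pair v ` outs (pverts T) v"
    using arc_snd_in_verts by (fastforce simp: out_arcs_def outs_def)
  then show ?thesis by (simp add: out_degree_def card_image inj_on_def)
qed

text \<open>\<open>V\<close> is a smallest vertex set inducing minimum out-degree at least \<open>m\<close>: if it had fewer than \<open>k\<close>
  vertices of out-degree below \<open>m + k\<close>, then \<open>k\<close> vertices could be deleted.\<close>

lemma ex_core:
  assumes "m \<le> min_out_degree (with_proj T)" "0 < k" "k \<le> m"
  obtains V B where "V \<subseteq> pverts T" "\<And>v. v \<in> V \<Longrightarrow> m \<le> card (outs V v)"
    "B \<subseteq> V" "card B = k" "\<And>v. v \<in> B \<Longrightarrow> card (outs V v) < m + k"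
proof -
  define good where "good V \<longleftrightarrow> V \<subseteq> pverts T \<and> V \<noteq> {} \<and> (\<forall>v\<in>V. m \<le> card (outs V v))" for V
  have "m \<le> card (outs (pverts T) v)" if "v \<in> pverts T" for v
  proof -
    have "min_out_degree (with_proj T) \<le> out_degree (with_proj T) v"
      unfolding min_out_degree_def using that pair_finite_verts by (intro Min_le) auto
    with assms(1) show ?thesis by (simp add: out_degree_eq_card_outs)
  qed
  then have "good (pverts T)" using nonempty_verts by (auto simp: good_def)
  then obtain V where V: "good V" and least: "\<And>V'. good V' \<Longrightarrow> card V \<le> card V'"
    by (metis ex_has_least_nat)
  have sub: "V \<subseteq> pverts T" and ne: "V \<noteq> {}" and deg: "\<And>v. v \<in> V \<Longrightarrow> m \<le> card (outs V v)"
    using V by (auto simp: good_def)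
  have fin: "finite V" using sub finite_subset pair_finite_verts by blast
  define L where "L = {v \<in> V. card (outs V v) < m + k}"
  have "k \<le> card L"
  proof (rule ccontr)
    assume less: "\<not> k \<le> card L"
    obtain v where v: "v \<in> V" using ne by auto
    \<comment> \<open>\<open>v\<close> and its out-neighbours give
      \<open>card V > m \<ge> k\<close>, so deleting \<open>k\<close> vertices leaves some.\<close>
    have "outs V v \<subseteq> V - {v}" using not_loop by (auto simp: outs_def)
    then have "card (outs V v) \<le> card V - 1"
      using fin v card_mono[of "V - {v}"] by fastforce
    moreover have "card V > 0" using fin v by (auto simp: card_gt_0_iff)
    ultimately have k: "k < card V" using deg[OF v] assms(3) by linarith
    \<comment> \<open>\<open>X\<close> takes in every vertex of out-degree below
      \<open>m + k\<close>; the others can afford to lose \<open>k\<close> out-neighbours.\<close>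
    obtain X where X: "L \<subseteq> X" "X \<subseteq> V" "card X = k"
      using exists_subset_between[of L k V] less k fin by (auto simp: L_def)
    have "good (V - X)"
      unfolding good_def
    proof (intro conjI ballI)
      show "V - X \<subseteq> pverts T" using sub by auto
      show "V - X \<noteq> {}" using k X fin by (metis Diff_eq_empty_iff card_mono leD
            finite_subset)
      fix u assume u: "u \<in> V - X"
      then have "m + k \<le> card (outs V u)" using X by (auto simp: L_def)
      moreover have "outs (V - X) u = outs V u - X" by (auto simp: outs_def)
      then have "card (outs V u) - card X \<le> card (outs (V - X) u)"
        using diff_card_le_card_Diff finite_subset[OF X(2) fin] by metis
      ultimately show "m \<le> card (outs (V - X) u)" using X(3) by linarith
    qed
    from least[OF this] show False
      using X k fin assms(2) by (simp add: card_Diff_subset finite_subset)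
  qed
  then obtain B where "B \<subseteq> L" "card B = k" by (metis obtain_subset_with_card_n)
  with that[of V B] sub deg show thesis by (auto simp: L_def)
qed


section \<open>Linking a single pair by a short path\<close>

lemma vpath_link1:
  assumes "(x, p) \<in> parcs T" "(p, y) \<in> parcs T" "x \<noteq> y"
  shows "vpath (x # [p] @ [y]) (with_proj T)"
  using assms not_loop in_arcsD1 in_arcsD2 by (auto simp: vpath_def vwalk_def)

lemma vpath_link2:
  assumes "(x, p) \<in> parcs T" "(p, q) \<in> parcs T" "(q, y) \<in> parcs T" "x \<noteq> y" "x \<noteq> q" "p \<noteq> y"
  shows "vpath (x # [p, q] @ [y]) (with_proj T)"
  using assms not_loop in_arcsD1 in_arcsD2 by (auto simp: vpath_def vwalk_def)

lemma out_neighbour_of_target: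
  assumes "V \<subseteq> pverts T" "y \<in> V \<inter> W" "v \<in> V - W" "(v, y) \<notin> parcs T"
  shows "v \<in> outs V y"
  using assms exactly_one_arc[of v y] by (auto simp: outs_def)

text \<open>Some vertex of the difference lies outside \<open>W\<close>; it differs from
  \<open>y \<in> W\<close>, so its arc with \<open>y\<close> points to \<open>y\<close>.\<close>

lemma ex_link1:
  assumes V: "V \<subseteq> pverts T" and y: "y \<in> V \<inter> W" and "x \<noteq> y" "finite W"
    and d: "card W < card (outs V x - outs V y)"
  obtains p where "p \<in> V - W" "vpath (x # [p] @ [y]) (with_proj T)"
proof -
  have "\<not> outs V x - outs V y \<subseteq> W" using d \<open>finite W\<close> by (meson card_mono leD)
  then obtain p where "p \<in> V - W" "(x, p) \<in> parcs T" "p \<notin> outs V y"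
    by (auto simp: outs_def)
  with out_neighbour_of_target[OF V y] \<open>x \<noteq> y\<close> that show thesis
    by (blast intro: vpath_link1)
qed

text \<open>\<open>W\<close> is meant to hold the \<open>k\<close> branch vertices and the inner
  vertices of \<open>i\<close> links, at least \<open>s\<close> of them with one inner vertex,
  whence \<open>card W \<le> k + 2 * i - s\<close>. A larger \<open>s\<close> admits a larger
  difference of out-neighbourhoods but requires a smaller \<open>W\<close>.\<close>

lemma ex_link2:
  assumes V: "V \<subseteq> pverts T" and deg: "\<And>v. v \<in> V \<Longrightarrow> m \<le> card (outs V v)"
    and x: "x \<in> V \<inter> W" and y: "y \<in> V \<inter> W" "card (outs V y) < m + k" and "x \<noteq> y"
    and W: "finite W" "card W + s \<le> k + 2 * i" and d: "card (outs V x - outs V y) \<le> k + s"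
    and m: "5 * k + 4 * i \<le> m"
  shows "\<exists>r. set r \<subseteq> V - W \<and> length r \<le> 2 \<and> vpath (x # r @ [y]) (with_proj T)"
proof (rule ccontr)
  assume no_link: "\<not> ?thesis"
  have blocked1: "(p, y) \<notin> parcs T" if "p \<in> V - W" "(x, p) \<in> parcs T" for p
  proof
    assume "(p, y) \<in> parcs T"
    with that \<open>x \<noteq> y\<close> have "vpath (x # [p] @ [y]) (with_proj T)" by (intro vpath_link1)
    with that(1) no_link show False by (auto dest!: spec[of _ "[p]"])
  qed
  have blocked2: "(q, y) \<notin> parcs T"
    if "p \<in> V - W" "(x, p) \<in> parcs T" "q \<in> V - W" "(p, q) \<in> parcs T" for p q
  proof
    assume "(q, y) \<in> parcs T"
    with that x y \<open>x \<noteq> y\<close> have "vpath (x # [p, q] @ [y]) (with_proj T)"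
      by (intro vpath_link2) auto
    with that(1,3) no_link show False by (auto dest!: spec[of _ "[p, q]"])
  qed
  have fin: "finite V" using V finite_subset pair_finite_verts by blast
  have fo: "finite (outs V v)" for v using V by (rule finite_outs)
  define P where "P = outs V x - W"
  define Q where "Q = outs V y - W"
  have "P \<subseteq> V - W" by (auto simp: P_def outs_def)
  have "P \<subseteq> Q"
    using blocked1 out_neighbour_of_target[OF V y(1)] by (auto simp: P_def Q_def outs_def)
  have card_P: "card P + card (outs V x \<inter> W) = card (outs V x)"
    unfolding P_def
    using card_Diff_subset_Int[of "outs V x" W] fo card_mono[OF fo, of "outs V x \<inter> W" x]
    by simp
  have card_Q: "card Q + card (outs V y \<inter> W) = card (outs V y)"
    unfolding Q_def
    using card_Diff_subset_Int[of "outs V y" W] fo card_mono[OF fo, of "outs V y \<inter> W" y]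
    by simp
  have "card (outs V x \<inter> W) \<le> card W" using W by (simp add: card_mono)
  \<comment> \<open>\<open>k > 0\<close>, as \<open>card (outs V y)\<close> is at least
    \<open>m\<close> and below \<open>m + k\<close>. So \<open>card W \<le> k + 2 * i < m\<close>,
    too few to contain \<open>outs V x\<close>.\<close>
  then have "P \<noteq> {}" using card_P deg[of x] x W m y by auto
  then obtain p where p: "p \<in> P" "2 * card (outs P p) < card P"
    using ex_low_out_degree[of P] V \<open>P \<subseteq> V - W\<close> by blast
  have "outs V p \<subseteq> W \<union> (outs P p \<union> (Q - P))"
  proof
    fix v assume v: "v \<in> outs V p"
    show "v \<in> W \<union> (outs P p \<union> (Q - P))"
    proof (cases "v \<in> W")
      case False
      with v p have "(v, y) \<notin> parcs T" by (intro blocked2[of p]) (auto simp: P_def outs_def)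
      with False v have "v \<in> Q"
        using out_neighbour_of_target[OF V y(1), of v] by (auto simp: Q_def outs_def)
      with v show ?thesis by (auto simp: outs_def)
    qed simp
  qed
  moreover have fPQ: "finite P" "finite Q" using fo by (auto simp: P_def Q_def)
  ultimately have "card (outs V p) \<le> card (W \<union> (outs P p \<union> (Q - P)))"
    using W by (intro card_mono) (auto simp: outs_def)
  also have "\<dots> \<le> card W + (card (outs P p) + card (Q - P))"
    by (meson card_Un_le add_left_mono order_trans)
  finally have "m \<le> card W + (card (outs P p) + card (Q - P))"
    using deg[of p] p \<open>P \<subseteq> V - W\<close> by fastforce
  moreover have "card (Q - P) + card P = card Q"
    using \<open>P \<subseteq> Q\<close> fPQ by (simp add: card_Diff_subset card_mono)
  moreover have "card (outs V x \<inter> W) \<le> card ((outs V y \<inter> W) \<union> (outs V x - outs V y))"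
    using fo by (intro card_mono) auto
  then have "card (outs V x \<inter> W) \<le> card (outs V y \<inter> W) + card (outs V x - outs V y)"
    by (meson card_Un_le order_trans)
  \<comment> \<open>Let \<open>a\<close>, \<open>b\<close> be the sizes of
    \<open>outs V x \<inter> W\<close> and \<open>outs V y \<inter> W\<close>, so
    \<open>a \<le> b + k + s\<close>. Then \<open>m < 2 * card W + 2 * k + a - 2 * b \<le> 2 * card
    W + 3 * k + s \<le> 5 * k + 4 * i - s\<close>.\<close>
  ultimately show False
    using card_P card_Q p(2) y(2) W(2) d m deg[of x] x by auto
qed

section \<open>Greedy linking of all pairs\<close>

text \<open>For distinct \<open>x\<close>, \<open>y\<close> in
  \<open>V \<subseteq> pverts T\<close>, the vertices counted, other than \<open>y\<close> itself,
  are the midpoints of the paths of length two from \<open>x\<close> to \<open>y\<close> through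
  \<open>V\<close>. The argument is a pair so that this can serve as a sort key.\<close>

definition outs_diff :: "'a set \<Rightarrow> 'a \<times> 'a \<Rightarrow> nat" where
  "outs_diff V = (\<lambda>(x, y). card (outs V x - outs V y))"

text \<open>The linking is greedy, in order of decreasing \<open>|N\<^sup>+(x) - N\<^sup>+(y)|\<close>. Once this quantity
  is too small to guarantee a path of length two, at step \<open>s\<close> say, it stays at most \<open>k + s\<close>,
  while each of the first \<open>s\<close> paths has a single internal vertex.\<close>

lemma ex_disjoint_links:
  assumes V: "V \<subseteq> pverts T" and deg: "\<And>v. v \<in> V \<Longrightarrow> m \<le> card (outs V v)"
    and B: "B \<subseteq> V" "card B = k" "\<And>v. v \<in> B \<Longrightarrow> card (outs V v) < m + k"
    and es: "distinct es" "\<And>x y. (x, y) \<in> set es \<Longrightarrow> x \<in> B \<and> y \<in> B \<and> x \<noteq> y"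
      "sorted_wrt (\<lambda>e f. outs_diff V f \<le> outs_diff V e) es"
    and m: "5 * k + 4 * length es \<le> m" and "i \<le> length es"
  shows "\<exists>R. (\<forall>x y. (x, y) \<in> set (take i es) \<longrightarrow> set (R (x, y)) \<subseteq> V - B \<and>
        vpath (x # R (x, y) @ [y]) (with_proj T)) \<and>
      (\<forall>e\<in>set (take i es). \<forall>f\<in>set (take i es). e \<noteq> f \<longrightarrow> set (R e) \<inter> set (R f) = {}) \<and>
      (card (\<Union>e\<in>set (take i es). set (R e)) \<le> i \<or>
       (\<exists>s<i. outs_diff V (es ! s) \<le> k + s \<and> card (\<Union>e\<in>set (take i es). set (R e)) + s \<le> 2 * i))"
  using \<open>i \<le> length es\<close>
proof (induction i)
  case 0
  show ?case by simp
next
  case (Suc i)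
  then obtain R where
    R_all: "\<forall>x y. (x, y) \<in> set (take i es) \<longrightarrow> set (R (x, y)) \<subseteq> V - B \<and>
        vpath (x # R (x, y) @ [y]) (with_proj T)"
    and disj_all: "\<forall>e\<in>set (take i es). \<forall>f\<in>set (take i es). e \<noteq> f \<longrightarrow> set (R e) \<inter> set (R f) = {}"
    and size: "card (\<Union>e\<in>set (take i es). set (R e)) \<le> i \<or>
       (\<exists>s<i. outs_diff V (es ! s) \<le> k + s \<and>
         card (\<Union>e\<in>set (take i es). set (R e)) + s \<le> 2 * i)"
    by (metis Suc_leD)
  note R = R_all[rule_format] and disj = disj_all[rule_format]
  define U where "U = (\<Union>e\<in>set (take i es). set (R e))"
  note size = size[folded U_def]
  define W where "W = B \<union> U"
  obtain x y where xy: "es ! i = (x, y)" by fastforce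
  have i: "i < length es" using Suc.prems by simp
  then have "(x, y) \<in> set es" using xy nth_mem by metis
  then have xyB: "x \<in> B" "y \<in> B" "x \<noteq> y" using es(2) by auto
  have finB: "finite B" using B(1) V pair_finite_verts by (meson finite_subset)
  have finU: "finite U" by (simp add: U_def)
  have finW: "finite W" using finB finU by (simp add: W_def)
  have cardW: "card W \<le> k + card U" using card_Un_le[of B U] B(2) by (simp add: W_def)
  have xyW: "x \<in> V \<inter> W" "y \<in> V \<inter> W" using xyB B(1) by (auto simp: W_def)
  have "\<exists>r. set r \<subseteq> V - W \<and> vpath (x # r @ [y]) (with_proj T) \<and>
    (card U + length r \<le> Suc i \<or>
       (\<exists>s<Suc i. outs_diff V (es ! s) \<le> k + s \<and> card U + length r + s \<le> 2 * Suc i))"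
  proof (cases "card W < outs_diff V (x, y)")
    case True
    then obtain p where "p \<in> V - W" "vpath (x # [p] @ [y]) (with_proj T)"
      using ex_link1[OF V xyW(2) xyB(3) finW] by (auto simp: outs_diff_def)
    moreover have "card U + 1 \<le> Suc i \<or>
       (\<exists>s<Suc i. outs_diff V (es ! s) \<le> k + s \<and> card U + 1 + s \<le> 2 * Suc i)"
      using size by fastforce
    ultimately show ?thesis by (intro exI[of _ "[p]"]) auto
  next
    case False
    \<comment> \<open>If \<open>card U \<le> i\<close>, the present step becomes the threshold
      \<open>s = i\<close>, as the difference is at most \<open>card W \<le> k + i\<close>.
      Otherwise the sorting carries the bound at the earlier \<open>s\<close> over to
      \<open>es ! i\<close>.\<close>
    have "\<exists>s<Suc i. outs_diff V (es ! s) \<le> k + s \<and> outs_diff V (x, y) \<le> k + s \<and> card U + s \<le> 2 * i"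
      using size
    proof (elim disjE exE conjE)
      assume "card U \<le> i"
      with False cardW xy show ?thesis by (intro exI[of _ i]) auto
    next
      fix s assume s: "s < i" "outs_diff V (es ! s) \<le> k + s" "card U + s \<le> 2 * i"
      then have "outs_diff V (es ! i) \<le> outs_diff V (es ! s)"
        using es(3) i by (simp add: sorted_wrt_iff_nth_less)
      with s xy show ?thesis by (intro exI[of _ s]) auto
    qed
    then obtain s where s: "s < Suc i" "outs_diff V (es ! s) \<le> k + s" "outs_diff V (x, y) \<le> k + s"
      "card U + s \<le> 2 * i" by blast
    have "\<exists>r. set r \<subseteq> V - W \<and> length r \<le> 2 \<and> vpath (x # r @ [y]) (with_proj T)"
    proof (rule ex_link2[OF V deg xyW _ xyB(3) finW])
      show "card (outs V y) < m + k" using B(3) xyB(2) .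
      show "card W + s \<le> k + 2 * i" using cardW s(4) by simp
      show "card (outs V x - outs V y) \<le> k + s" using s(3) by (simp add: outs_diff_def)
      show "5 * k + 4 * i \<le> m" using m i by simp
    qed
    then obtain r where r: "set r \<subseteq> V - W" "length r \<le> 2" "vpath (x # r @ [y]) (with_proj T)"
      by blast
    moreover have "card U + length r + s \<le> 2 * Suc i" using r(2) s(4) by simp
    ultimately show ?thesis using s(1,2) by blast
  qed
  then obtain r where r: "set r \<subseteq> V - W" "vpath (x # r @ [y]) (with_proj T)"
    and size': "card U + length r \<le> Suc i \<or>
       (\<exists>s<Suc i. outs_diff V (es ! s) \<le> k + s \<and> card U + length r + s \<le> 2 * Suc i)" by blast
  define R' where "R' = R((x, y) := r)"
  have take_Suc: "set (take (Suc i) es) = insert (x, y) (set (take i es))"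
    using i xy by (simp add: take_Suc_conv_app_nth)
  have new: "(x, y) \<notin> set (take i es)"
    using es(1) i xy by (metis distinct_take distinct_append take_Suc_conv_app_nth
        not_distinct_conv_prefix append_Nil2 distinct.simps(2) disjoint_iff list.set_intros(1))
  have R'_old: "R' e = R e" if "e \<in> set (take i es)" for e
    using that new by (auto simp: R'_def)
  have R'_new: "R' (x, y) = r" by (simp add: R'_def)
  have U': "(\<Union>e\<in>set (take (Suc i) es). set (R' e)) = U \<union> set r"
    unfolding take_Suc U_def using R'_old R'_new by auto
  have "card (U \<union> set r) \<le> card U + length r"
    by (meson card_Un_le card_length add_left_mono order_trans)
  then have "card (U \<union> set r) \<le> Suc i \<or>
       (\<exists>s<Suc i. outs_diff V (es ! s) \<le> k + s \<and> card (U \<union> set r) + s \<le> 2 * Suc i)"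
    using size' by (meson add_le_mono1 order_trans)
  moreover have "set r \<inter> set (R e) = {}" if "e \<in> set (take i es)" for e
    using r(1) that by (auto simp: W_def U_def)
  then have "\<forall>e\<in>set (take (Suc i) es). \<forall>f\<in>set (take (Suc i) es).
      e \<noteq> f \<longrightarrow> set (R' e) \<inter> set (R' f) = {}"
    unfolding take_Suc using disj R'_old R'_new by (metis inf_commute insert_iff)
  moreover have "\<forall>u v. (u, v) \<in> set (take (Suc i) es) \<longrightarrow> set (R' (u, v)) \<subseteq> V - B \<and>
        vpath (u # R' (u, v) @ [v]) (with_proj T)"
    unfolding take_Suc using r R R'_old R'_new by (auto simp: W_def)
  ultimately show ?case unfolding U'[symmetric] by blast
qed

text \<open>The constant is \<open>5 * k + 4 * (k * (k - 1) / 2)\<close>: exactly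
  \<open>k * (k - 1) / 2\<close> ordered pairs of distinct branch vertices are not arcs.\<close>

lemma contains_complete_subdivision_if_min_out_degree:
  assumes "2 * k\<^sup>2 + 3 * k \<le> min_out_degree (with_proj T)" "0 < k"
  shows "contains_complete_subdivision (with_proj T) k"
proof -
  define m where "m = 2 * k\<^sup>2 + 3 * k"
  obtain V B where V: "V \<subseteq> pverts T" and deg: "\<And>v. v \<in> V \<Longrightarrow> m \<le> card (outs V v)"
    and B: "B \<subseteq> V" "card B = k" "\<And>v. v \<in> B \<Longrightarrow> card (outs V v) < m + k"
    using ex_core[of m k] assms by (auto simp: m_def)
  have BT: "B \<subseteq> pverts T" using B V by auto
  have finB: "finite B" using BT pair_finite_verts by (rule finite_subset)
  define F where "F = {e \<in> B \<times> B. e \<in> parcs T}"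
  obtain es0 where es0: "set es0 = prod.swap ` F" "distinct es0"
    using finite_distinct_list[of "prod.swap ` F"] finB by (auto simp: F_def)
  define es where "es = rev (sort_key (outs_diff V) es0)"
  have set_es: "set es = prod.swap ` F" and "distinct es"
    using es0 by (simp_all add: es_def)
  have "sorted_wrt (\<lambda>e f. outs_diff V f \<le> outs_diff V e) es"
    using sorted_sort_key[of "outs_diff V" es0] by (simp add: es_def sorted_wrt_rev sorted_wrt_map)
  moreover have "length es = card F"
    using set_es \<open>distinct es\<close> distinct_card[of es] by (simp add: card_image)
  then have "2 * length es + k = k * k"
    using card_arcs_within[OF BT] B(2) by (simp add: F_def)
  then have "5 * k + 4 * length es \<le> m" by (simp add: m_def power2_eq_square)
  moreover have es: "(x, y) \<in> set es \<longleftrightarrow> x \<in> B \<and> y \<in> B \<and> (y, x) \<in> parcs T" for x y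
    unfolding set_es by (auto simp: F_def)
  ultimately obtain R where
    R_all: "\<forall>x y. (x, y) \<in> set es \<longrightarrow> set (R (x, y)) \<subseteq> V - B \<and>
        vpath (x # R (x, y) @ [y]) (with_proj T)"
    and disj_all: "\<forall>e\<in>set es. \<forall>f\<in>set es. e \<noteq> f \<longrightarrow> set (R e) \<inter> set (R f) = {}"
    using ex_disjoint_links[OF V deg B \<open>distinct es\<close>, where i = "length es"] not_loop
    by (metis le_refl take_all)
  note R = R_all[rule_format] and disj = disj_all[rule_format]
  define P where "P x y = (if (x, y) \<in> parcs T then [x, y] else x # R (x, y) @ [y])" for x y
  have internal: "internal_verts (P x y) = (if (x, y) \<in> parcs T then {} else set (R (x, y)))" for x y
    by (simp add: P_def internal_verts_def)
  have reversed: "(x, y) \<in> set es" if "x \<in> B" "y \<in> B" "x \<noteq> y" "(x, y) \<notin> parcs T" for x y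
    using that BT exactly_one_arc[of x y] by (auto simp: es)
  have path: "vpath (P x y) (with_proj T) \<and> hd (P x y) = x \<and> last (P x y) = y \<and>
      internal_verts (P x y) \<inter> B = {}" if xy: "x \<in> B" "y \<in> B" "x \<noteq> y" for x y
  proof (cases "(x, y) \<in> parcs T")
    case True
    with xy BT show ?thesis by (auto simp: P_def internal_verts_def vpath_def vwalk_def)
  next
    case False
    with R[OF reversed[OF xy False]] show ?thesis unfolding internal by (auto simp: P_def)
  qed
  show ?thesis
    unfolding contains_complete_subdivision_def
  proof (intro exI[of _ B] exI[of _ P] conjI)
    show "B \<subseteq> verts (with_proj T)" using BT by simp
    show "\<forall>x\<in>B. \<forall>y\<in>B. \<forall>x'\<in>B. \<forall>y'\<in>B. x \<noteq> y \<longrightarrow> x' \<noteq> y' \<longrightarrow> (x, y) \<noteq> (x', y') \<longrightarrow>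
        internal_verts (P x y) \<inter> internal_verts (P x' y') = {}"
      unfolding internal using disj reversed by auto
  qed (use finB B(2) path in auto)
qed

section \<open>Lower bound: counting internal vertices, rotational tournaments\<close>

lemma card_verts_if_contains_complete_subdivision:
  assumes "contains_complete_subdivision (with_proj T) k"
  shows "k * k + k \<le> 2 * card (pverts T)"
proof -
  obtain B P where BT: "B \<subseteq> pverts T" and k: "card B = k"
    and path: "\<And>x y. x \<in> B \<Longrightarrow> y \<in> B \<Longrightarrow> x \<noteq> y \<Longrightarrow> vpath (P x y) (with_proj T) \<and>
      hd (P x y) = x \<and> last (P x y) = y \<and> internal_verts (P x y) \<inter> B = {}"
    and disj: "\<And>x y x' y'. x \<in> B \<Longrightarrow> y \<in> B \<Longrightarrow> x' \<in> B \<Longrightarrow> y' \<in> B \<Longrightarrow> x \<noteq> y \<Longrightarrow> x' \<noteq> y' \<Longrightarrow>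
      (x, y) \<noteq> (x', y') \<Longrightarrow> internal_verts (P x y) \<inter> internal_verts (P x' y') = {}"
    using assms unfolding contains_complete_subdivision_def by auto metis
  have finB: "finite B" using BT pair_finite_verts by (rule finite_subset)
  define F where "F = {e \<in> B \<times> B. e \<in> parcs T}"
  \<comment> \<open>The arc \<open>(y, x)\<close> indexes the path in the opposite direction, from
    \<open>x\<close> to \<open>y\<close>, which cannot be a single arc.\<close>
  define I where "I = (\<lambda>(y, x). internal_verts (P x y))"
  have F: "(y, x) \<in> F \<Longrightarrow> x \<in> B \<and> y \<in> B \<and> x \<noteq> y \<and> (x, y) \<notin> parcs T" for x y
    using exactly_one_arc[of y x] BT not_loop by (auto simp: F_def)
  have I: "I e \<subseteq> pverts T - B" "I e \<noteq> {}" if eF: "e \<in> F" for e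
  proof -
    obtain x y where e: "e = (y, x)" by fastforce
    note xy = F[OF eF[unfolded e]]
    then have p: "vpath (P x y) (with_proj T)" "hd (P x y) = x" "last (P x y) = y"
      "internal_verts (P x y) \<inter> B = {}" using path by auto
    then show "I e \<subseteq> pverts T - B"
      using internal_verts_subset[of "P x y"] by (auto simp: I_def e vpath_def vwalk_def)
    obtain z zs where z: "P x y = x # z # zs"
      using p xy by (metis hd_Cons_tl last.simps vpath_def vwalk_def)
    have "zs \<noteq> []"
      using p xy z by (auto simp: vpath_def vwalk_def)
    then show "I e \<noteq> {}" by (simp add: I_def e internal_verts_def z)
  qed
  have disjI: "I e \<inter> I f = {}" if "e \<in> F" "f \<in> F" "e \<noteq> f" for e f
  proof -
    obtain x y x' y' where ef: "e = (y, x)" "f = (y', x')" by fastforce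
    from disj[of x y x' y'] F[of y x] F[of y' x'] that show ?thesis
      by (simp add: ef I_def) blast
  qed
  \<comment> \<open>One internal vertex per arc of \<open>F\<close>; disjointness of the paths makes
    the choice injective.\<close>
  define g where "g e = (SOME v. v \<in> I e)" for e
  have g: "g e \<in> I e" if "e \<in> F" for e
    unfolding g_def using I(2)[OF that] by (simp add: some_in_eq)
  have "inj_on g F"
  proof (rule inj_onI, rule ccontr)
    fix e f assume "e \<in> F" "f \<in> F" "g e = g f" "e \<noteq> f"
    with g[of e] g[of f] disjI[of e f] show False by auto
  qed
  moreover have "g ` F \<subseteq> pverts T - B" using g I(1) by blast
  ultimately have "card F \<le> card (pverts T - B)"
    using pair_finite_verts by (metis card_image card_mono finite_Diff)
  also have "\<dots> = card (pverts T) - k" using k BT finB by (simp add: card_Diff_subset)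
  finally have "card F + k \<le> card (pverts T)"
    using card_mono[OF pair_finite_verts BT] k by simp
  then show ?thesis using card_arcs_within[OF BT] k by (simp add: F_def)
qed

end

text \<open>The out-neighbours of \<open>i\<close> are \<open>i + 1, \<dots>, i + m\<close> modulo \<open>2 m + 1\<close>.\<close>

definition rotational_tournament :: "nat \<Rightarrow> nat pair_pre_digraph" where
  "rotational_tournament m = \<lparr>pverts = {..2 * m},
     parcs = {(i, j). i \<le> 2 * m \<and> j \<le> 2 * m \<and> (i < j \<and> j \<le> i + m \<or> j + m < i)}\<rparr>"

lemma tournament_rotational: "tournament (rotational_tournament m)"
proof
  show "finite (parcs (rotational_tournament m))"
    by (rule finite_subset[of _ "{..2 * m} \<times> {..2 * m}"]) (auto simp: rotational_tournament_def)
qed (auto simp: rotational_tournament_def)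

lemma min_out_degree_rotational: "min_out_degree (with_proj (rotational_tournament m)) = m"
proof -
  interpret tournament "rotational_tournament m" by (rule tournament_rotational)
  have "out_degree (with_proj (rotational_tournament m)) i = m" if "i \<le> 2 * m" for i
  proof -
    \<comment> \<open>Out-neighbours without and with wrap-around. For \<open>i \<le> m\<close> the
      intervals have \<open>m\<close> and \<open>0\<close> elements, by truncated subtraction; for
      larger \<open>i\<close> they have \<open>2 * m - i\<close> and \<open>i - m\<close>.\<close>
    have "outs (pverts (rotational_tournament m)) i = {i<..min (i + m) (2 * m)} \<union> {..<i - m}"
      using that unfolding outs_def by (auto simp: rotational_tournament_def)
    then have "card (outs (pverts (rotational_tournament m)) i) =
        (min (i + m) (2 * m) - i) + (i - m)"
      by (subst \<open>outs _ i = _\<close>, subst card_Un_disjoint) auto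
    also have "\<dots> = m" using that by auto
    finally show ?thesis by (simp add: out_degree_eq_card_outs)
  qed
  then have "out_degree (with_proj (rotational_tournament m)) `
      verts (with_proj (rotational_tournament m)) = {m}"
    by (auto simp: rotational_tournament_def image_iff)
  then show ?thesis by (simp add: min_out_degree_def)
qed

text \<open>On \<open>2 * m + 1\<close> vertices the count gives
  \<open>k * k + k \<le> 4 * m + 2\<close>, and \<open>k \<ge> 2\<close> absorbs the
  \<open>2\<close>.\<close>

lemma forces_complete_subdivision_lower:
  assumes "forces_complete_subdivision k m" "2 \<le> k"
  shows "k\<^sup>2 \<le> 4 * m"
proof -
  have "contains_complete_subdivision (with_proj (rotational_tournament m)) k"
    using assms(1) tournament_rotational[of m] min_out_degree_rotational[of m]
    by (simp add: forces_complete_subdivision_def)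
  then have "k * k + k \<le> 2 * card (pverts (rotational_tournament m))"
    by (rule tournament.card_verts_if_contains_complete_subdivision[OF tournament_rotational])
  with assms(2) show ?thesis by (simp add: rotational_tournament_def power2_eq_square)
qed

section \<open>The bounds for \<open>d_min\<close>\<close>

lemma forces_complete_subdivision_upper:
  "0 < k \<Longrightarrow> forces_complete_subdivision k (2 * k\<^sup>2 + 3 * k)"
  by (simp add: forces_complete_subdivision_def
      tournament.contains_complete_subdivision_if_min_out_degree)

theorem theorem1p1:
  shows "(\<forall>k\<ge>2. \<exists>m. forces_complete_subdivision k m) \<and>
    (\<forall>k\<ge>2. (real k)\<^sup>2 / 4 \<le> real (d_min k)) \<and>
    (\<exists>\<epsilon> :: nat \<Rightarrow> real. \<epsilon> \<longlonglongrightarrow> 0 \<and>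
       (\<forall>k\<ge>2. real (d_min k) \<le> (2 + \<epsilon> k) * (real k)\<^sup>2))"
proof (intro conjI allI impI)
  fix k :: nat
  assume "2 \<le> k"
  then have upper: "forces_complete_subdivision k (2 * k\<^sup>2 + 3 * k)"
    by (simp add: forces_complete_subdivision_upper)
  then show "\<exists>m. forces_complete_subdivision k m" ..
  have "forces_complete_subdivision k (d_min k)"
    unfolding d_min_def using upper by (rule LeastI)
  then have "k\<^sup>2 \<le> 4 * d_min k"
    using \<open>2 \<le> k\<close> by (rule forces_complete_subdivision_lower)
  then have "real (k\<^sup>2) \<le> real (4 * d_min k)" by (rule of_nat_mono)
  then show "(real k)\<^sup>2 / 4 \<le> real (d_min k)" by simp
next
  show "\<exists>\<epsilon> :: nat \<Rightarrow> real. \<epsilon> \<longlonglongrightarrow> 0 \<and>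
       (\<forall>k\<ge>2. real (d_min k) \<le> (2 + \<epsilon> k) * (real k)\<^sup>2)"
  \<comment> \<open>The witness makes \<open>2 * k\<^sup>2 + 3 * k\<close> equal to
    \<open>(2 + 3 / k) * k\<^sup>2\<close>.\<close>
  proof (intro exI[of _ "\<lambda>k. 3 / real k"] conjI allI impI)
    show "(\<lambda>k. 3 / real k) \<longlonglongrightarrow> 0" by (rule lim_const_over_n)
    fix k :: nat
    assume "2 \<le> k"
    then have "d_min k \<le> 2 * k\<^sup>2 + 3 * k"
      unfolding d_min_def by (intro Least_le forces_complete_subdivision_upper) simp
    then have "real (d_min k) \<le> real (2 * k\<^sup>2 + 3 * k)" by (rule of_nat_mono)
    also have "\<dots> = (2 + 3 / real k) * (real k)\<^sup>2"
      using \<open>2 \<le> k\<close> by (simp add: field_simps power2_eq_square)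
    finally show "real (d_min k) \<le> (2 + 3 / real k) * (real k)\<^sup>2" .
  qed
qed

end
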